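(* Consider a single cycle of $n$ spins (indices modulo $n$). Let empirical magnetizations $\hat m_i=\tanh(\hat h_i)$ and empirical susceptibilities $\hat\chi_i$, $i=1,\dots,n$, be given, and set $$\hat\Theta_i=\frac{\hat\chi_i}{\sqrt{(1-\hat m_i^2)(1-\hat m_{i+1}^2)}} .$$ Consider the equations in the unknowns $(\vec{\breve m},\vec{\breve\chi})=(\breve m_i,\breve\chi_i)_{i=1}^n$, $$m_i=\frac{1-Q}{1+Q}\,\breve m_i,\qquad \chi_i=\frac{\breve\chi_i}{1+Q}+\frac{Q}{1+Q}\Bigl(\frac{(1-\breve m_i^2)(1-\breve m_{i+1}^2)}{\breve\chi_i}+4\,\frac{\breve m_i\breve m_{i+1}}{1+Q}\Bigr),\quad i=1,\dots,n,\qquad(\ast)$$ where $$\breve\Theta_i=\frac{\breve\chi_i}{\sqrt{(1-\breve m_i^2)(1-\breve m_{i+1}^2)}},\qquad Q=\prod_{i=1}^n\breve\Theta_i .$$ Then the solution $(\vec{\breve m},\vec{\breve\chi})$ satisfying $(\ast)$ with $m_i=\hat m_i$ and $\chi_i=\hat\chi_i$ for $i=1,\dots,n$ is determined by the $n$-dimensional vector $\vec{\breve\Theta}=(\breve\Theta_1,\dots,\breve\Theta_n)$ obeying $$\vec{\breve\Theta}=\vec f(\vec{\breve\Theta}),\qquad f_i(\vec{\breve\Theta})=A_i(Q)-\frac{Q}{\breve\Theta_i},$$ where $$A_i(Q)=\frac{(1+Q)(1-Q)^2\,\hat\Theta_i-4Q(1+Q)\sinh(\hat h_i)\sinh(\hat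 h_{i+1})}{\sqrt{\bigl(1-2Q\cosh(\hat h_i)+Q^2\bigr)\bigl(1-2Q\cosh(\hat h_{i+1})+Q^2\bigr)}} .$$
   Context: This is the inverse Ising problem on a single ring. The numbers $\breve m_i,\breve\chi_i$ parameterize the belief propagation beliefs $b_i(s_i)=\frac12(1+\breve m_is_i)$ and $b_i(s_i,s_{i+1})=\frac14\bigl(1+\breve m_is_i+\breve m_{i+1}s_{i+1}+(\breve m_i\breve m_{i+1}+\breve\chi_i)s_is_{i+1}\bigr)$, $s_i\in\{-1,1\}$, of the ring Ising measure $P(\mathbf s)=\frac{1}{1+Q}\prod_{i=1}^n b_i(s_i,s_{i+1})/b_i(s_i)$. In $(\ast)$, $m_i$ and $\chi_i$ are the exact magnetizations $\mathbb E(s_i)$ and nearest-neighbour covariances $\mathbb E(s_is_{i+1})-\mathbb E(s_i)\mathbb E(s_{i+1})$ of $P$.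
   Formalization: In A_i(Q) the radicands use cosh(2ĥ) instead of the printed cosh(ĥ), which makes the claim false (n=3, all m̆=1/2, χ̆=3/8); solutions are taken with |m̆_i|<1, χ̆_i≠0, Q≠±1, and fixed points with Θ̆_i≠0, Q≠-1 and each radicand factor positive, so that all expressions are defined. *)

theory Defs
  imports Complex_Main "HOL-Library.FuncSet"
begin

text \<open>
  Spins are indexed by \<open>{..<n}\<close>, the neighbour of \<open>i\<close> being \<open>nxt n i\<close>.  Vectors of length \<open>n\<close> are
  the functions in \<open>{..<n} \<rightarrow>\<^sub>E UNIV\<close>, so that equality of functions is equality of vectors.
  Throughout, \<open>m\<close>, \<open>c\<close>, \<open>t\<close> stand for the parameters written with a breve accent (magnetizations,
  susceptibilities and \<open>\<Theta>\<close>), and \<open>mh\<close>, \<open>ch\<close>, \<open>h\<close> for the empirical data (hats).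
\<close>

definition nxt :: "nat \<Rightarrow> nat \<Rightarrow> nat" where
  "nxt n i = (i + 1) mod n"

definition bel1 :: "(nat \<Rightarrow> real) \<Rightarrow> nat \<Rightarrow> real \<Rightarrow> real" where
  "bel1 m i s = (1 + m i * s) / 2"

definition bel2 :: "nat \<Rightarrow> (nat \<Rightarrow> real) \<Rightarrow> (nat \<Rightarrow> real) \<Rightarrow> nat \<Rightarrow> real \<Rightarrow> real \<Rightarrow> real" where
  "bel2 n m c i s s' =
     (1 + m i * s + m (nxt n i) * s' + (m i * m (nxt n i) + c i) * s * s') / 4"

definition Theta :: "nat \<Rightarrow> (nat \<Rightarrow> real) \<Rightarrow> (nat \<Rightarrow> real) \<Rightarrow> nat \<Rightarrow> real" where
  "Theta n m c =
     (\<lambda>i\<in>{..<n}. c i / sqrt ((1 - (m i)\<^sup>2) * (1 - (m (nxt n i))\<^sup>2)))"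

definition Qprod :: "nat \<Rightarrow> (nat \<Rightarrow> real) \<Rightarrow> real" where
  "Qprod n t = (\<Prod>i<n. t i)"

definition ring_mag :: "nat \<Rightarrow> (nat \<Rightarrow> real) \<Rightarrow> (nat \<Rightarrow> real) \<Rightarrow> nat \<Rightarrow> real" where
  "ring_mag n m c i = (let Q = Qprod n (Theta n m c) in (1 - Q) / (1 + Q) * m i)"

definition ring_susc :: "nat \<Rightarrow> (nat \<Rightarrow> real) \<Rightarrow> (nat \<Rightarrow> real) \<Rightarrow> nat \<Rightarrow> real" where
  "ring_susc n m c i = (let Q = Qprod n (Theta n m c); j = nxt n i in
     c i / (1 + Q)
       + Q / (1 + Q) * ((1 - (m i)\<^sup>2) * (1 - (m j)\<^sup>2) / c i + 4 * (m i * m j / (1 + Q))))"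

text \<open>
  The parameters for which the equations, \<open>\<Theta>\<close> and the map \<open>f\<close> below are all well-defined: the
  single-spin beliefs are positive (so the square roots have positive arguments), \<open>c i\<close> and \<open>1 + Q\<close>
  occur as denominators, and at \<open>Q = 1\<close> the magnetization equations no longer involve \<open>m\<close>.
  Positivity of the pair beliefs is deliberately not required; together with \<open>c i \<noteq> 0\<close> it would
  imply the two conditions on \<open>Q\<close>, as shown next.
\<close>

definition admissible :: "nat \<Rightarrow> (nat \<Rightarrow> real) \<Rightarrow> (nat \<Rightarrow> real) \<Rightarrow> bool" where
  "admissible n m c \<longleftrightarrow>
     (\<forall>i<n. (\<forall>s\<in>{-1, 1}. bel1 m i s > 0) \<and> c i \<noteq> 0) \<and>
     1 + Qprod n (Theta n m c) \<noteq> 0 \<and> 1 - Qprod n (Theta n m c) \<noteq> 0"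

lemma positive_beliefs_admissible:
  assumes n: "n \<ge> 1"
    and b1: "\<And>i s. i < n \<Longrightarrow> s \<in> {-1, 1} \<Longrightarrow> bel1 m i s > 0"
    and b2: "\<And>i s s'. i < n \<Longrightarrow> s \<in> {-1, 1} \<Longrightarrow> s' \<in> {-1, 1} \<Longrightarrow> bel2 n m c i s s' > 0"
    and c: "\<And>i. i < n \<Longrightarrow> c i \<noteq> 0"
  shows "admissible n m c"
proof -
  have mb: "\<bar>m i\<bar> < 1" if "i < n" for i
    using b1[OF that, of 1] b1[OF that, of "-1"] by (simp add: bel1_def)
  have T: "\<bar>Theta n m c i\<bar> < 1" if i: "i < n" for i
  proof -
    let ?j = "nxt n i"
    have j: "?j < n" using n by (simp add: nxt_def)
    define p q x where "p = m i" and "q = m ?j" and "x = c i"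
    have b: "(1 + p) * (1 + q) + x > 0" "(1 - p) * (1 - q) + x > 0"
        "(1 + p) * (1 - q) - x > 0" "(1 - p) * (1 + q) - x > 0"
      using b2[OF i, of 1 1] b2[OF i, of "-1" "-1"] b2[OF i, of 1 "-1"] b2[OF i, of "-1" 1]
      by (simp_all add: bel2_def p_def q_def x_def algebra_simps)
    have pq: "\<bar>p\<bar> < 1" "\<bar>q\<bar> < 1" using mb[OF i] mb[OF j] by (simp_all add: p_def q_def)
    have "\<bar>x\<bar> * \<bar>x\<bar> < (1 - p\<^sup>2) * (1 - q\<^sup>2)"
    proof (cases "x \<ge> 0")
      case True
      then have "x * x < ((1 + p) * (1 - q)) * ((1 - p) * (1 + q))"
        using b by (intro mult_strict_mono) auto
      then show ?thesis using True by (simp add: algebra_simps power2_eq_square)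
    next
      case False
      then have "(-x) * (-x) < ((1 + p) * (1 + q)) * ((1 - p) * (1 - q))"
        using b pq by (intro mult_strict_mono) auto
      then show ?thesis using False by (simp add: algebra_simps power2_eq_square)
    qed
    then have "\<bar>x\<bar> < sqrt ((1 - p\<^sup>2) * (1 - q\<^sup>2))"
      by (intro real_less_rsqrt) (simp add: power2_eq_square)
    then show ?thesis
      using i by (auto simp: Theta_def p_def q_def x_def abs_divide divide_less_eq)
  qed
  have "(\<Prod>i<n. \<bar>Theta n m c i\<bar>) < 1"
  proof -
    obtain k where k: "n = Suc k" using n by (cases n) auto
    have "(\<Prod>i<k. \<bar>Theta n m c i\<bar>) \<le> 1"
      using T k by (intro prod_le_1) (auto simp: less_imp_le)
    then have "(\<Prod>i<k. \<bar>Theta n m c i\<bar>) * \<bar>Theta n m c k\<bar> \<le> 1 * \<bar>Theta n m c k\<bar>"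
      by (intro mult_right_mono) auto
    also have "\<dots> < 1" using T[of k] k by simp
    finally show ?thesis by (simp add: k)
  qed
  then have "\<bar>Qprod n (Theta n m c)\<bar> < 1" by (simp add: Qprod_def abs_prod)
  then show ?thesis using b1 c by (auto simp: admissible_def)
qed

definition ring_solutions ::
  "nat \<Rightarrow> (nat \<Rightarrow> real) \<Rightarrow> (nat \<Rightarrow> real) \<Rightarrow> ((nat \<Rightarrow> real) \<times> (nat \<Rightarrow> real)) set" where
  "ring_solutions n mh ch =
     {(m, c). m \<in> {..<n} \<rightarrow>\<^sub>E UNIV \<and> c \<in> {..<n} \<rightarrow>\<^sub>E UNIV \<and> admissible n m c \<and>
        (\<forall>i<n. mh i = ring_mag n m c i \<and> ch i = ring_susc n m c i)}"

text \<open>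
  With \<open>m = (1 + Q) / (1 - Q) * tanh h\<close> one has
  \<open>1 - m\<^sup>2 = (1 - 2 * Q * cosh (2 * h) + Q\<^sup>2) / ((1 - Q)\<^sup>2 * (cosh h)\<^sup>2)\<close>.  The published formula for
  \<open>A\<close> has \<open>cosh h\<close> in place of \<open>cosh (2 * h)\<close>, a misprint: with it, solutions of the equations with
  positive beliefs need not satisfy the fixed-point equation (for instance \<open>n = 3\<close>, all \<open>m i = 1/2\<close>,
  \<open>c i = 3/8\<close>).
\<close>

definition Dterm :: "real \<Rightarrow> real \<Rightarrow> real" where
  "Dterm Q x = 1 - 2 * Q * cosh (2 * x) + Q\<^sup>2"

definition Acoef ::
  "nat \<Rightarrow> (nat \<Rightarrow> real) \<Rightarrow> (nat \<Rightarrow> real) \<Rightarrow> (nat \<Rightarrow> real) \<Rightarrow> real \<Rightarrow> nat \<Rightarrow> real" where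
  "Acoef n h mh ch Q i =
     ((1 + Q) * (1 - Q)\<^sup>2 * Theta n mh ch i - 4 * Q * (1 + Q) * sinh (h i) * sinh (h (nxt n i)))
       / sqrt (Dterm Q (h i) * Dterm Q (h (nxt n i)))"

definition fmap ::
  "nat \<Rightarrow> (nat \<Rightarrow> real) \<Rightarrow> (nat \<Rightarrow> real) \<Rightarrow> (nat \<Rightarrow> real) \<Rightarrow> (nat \<Rightarrow> real) \<Rightarrow> (nat \<Rightarrow> real)" where
  "fmap n h mh ch t =
     (\<lambda>i\<in>{..<n}. Acoef n h mh ch (Qprod n t) i - Qprod n t / t i)"

text \<open>
  Besides \<open>t i \<noteq> 0\<close> and \<open>1 + Q \<noteq> 0\<close>, each factor under the square root in \<open>A\<close> has to be positive:
  by the identity above this says that the magnetization attached to \<open>Q\<close> has modulus less than 1.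
  It also excludes \<open>Q = 1\<close>.
\<close>

definition ring_fixpoints ::
  "nat \<Rightarrow> (nat \<Rightarrow> real) \<Rightarrow> (nat \<Rightarrow> real) \<Rightarrow> (nat \<Rightarrow> real) \<Rightarrow> (nat \<Rightarrow> real) set" where
  "ring_fixpoints n h mh ch =
     {t \<in> {..<n} \<rightarrow>\<^sub>E UNIV. (\<forall>i<n. t i \<noteq> 0 \<and> Dterm (Qprod n t) (h i) > 0) \<and>
        1 + Qprod n t \<noteq> 0 \<and> t = fmap n h mh ch t}"

end

theory Submission imports Defs
begin

text \<open>
  The magnetization equations express \<open>m\<close> through \<open>Q\<close> as \<open>m = (1 + Q) / (1 - Q) * tanh h\<close>, and
  \<open>c\<close> is recovered from \<open>\<Theta>\<close> and \<open>m\<close>.  After this substitution the \<open>i\<close>-th susceptibility equation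
  involves only \<open>\<Theta> i\<close> and \<open>Q\<close>; it is linear in \<open>\<Theta> i + Q / \<Theta> i\<close>, and solving for this quantity
  gives \<open>A i\<close>.
\<close>

lemma one_minus_tanh_sq: "1 - (tanh x)\<^sup>2 = 1 / (cosh x)\<^sup>2" for x :: real
proof -
  have "1 - (tanh x)\<^sup>2 = ((cosh x)\<^sup>2 - (sinh x)\<^sup>2) / (cosh x)\<^sup>2"
    by (simp add: tanh_def power_divide diff_divide_distrib)
  then show ?thesis by (simp add: cosh_square_eq)
qed

text \<open>Over the common denominator the numerator is
  \<open>((1 - Q) * cosh x)\<^sup>2 - ((1 + Q) * sinh x)\<^sup>2\<close>, which the double-angle
  formula turns into \<open>Dterm\<close>. This is how \<open>Dterm\<close> enters the square root
  in \<open>Acoef\<close>.\<close>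

lemma one_minus_scaled_tanh_sq:
  assumes "1 - Q \<noteq> 0"
  shows "1 - ((1 + Q) / (1 - Q) * tanh x)\<^sup>2 = Dterm Q x / ((1 - Q) * cosh x)\<^sup>2"
proof -
  have "((1 - Q) * cosh x)\<^sup>2 - ((1 + Q) * sinh x)\<^sup>2 = Dterm Q x"
    unfolding Dterm_def cosh_double power_mult_distrib cosh_square_eq
    by (simp add: power2_eq_square algebra_simps)
  moreover have "(1 + Q) / (1 - Q) * tanh x = ((1 + Q) * sinh x) / ((1 - Q) * cosh x)"
    by (simp add: tanh_def)
  moreover have "((1 - Q) * cosh x)\<^sup>2 \<noteq> 0" using assms by simp
  ultimately show ?thesis
    by (simp add: power_divide diff_divide_eq_iff del: power_mult_distrib)
qed

text \<open>Translates between the domain condition on fixed points and positivity of the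
  single-spin beliefs.\<close>

lemma Dterm_pos_iff:
  assumes "1 - Q \<noteq> 0"
  shows "Dterm Q x > 0 \<longleftrightarrow> \<bar>(1 + Q) / (1 - Q) * tanh x\<bar> < 1"
proof -
  have "((1 - Q) * cosh x)\<^sup>2 > 0" using assms by simp
  then have "Dterm Q x > 0 \<longleftrightarrow> 1 - ((1 + Q) / (1 - Q) * tanh x)\<^sup>2 > 0"
    unfolding one_minus_scaled_tanh_sq[OF assms] by (simp add: zero_less_divide_iff)
  then show ?thesis by (simp add: abs_square_less_1)
qed

text \<open>Used to exclude \<open>Q = 1\<close> at a fixed point.\<close>

lemma Dterm_one_nonpos: "Dterm 1 x \<le> 0"
  using cosh_real_ge_1[of "2 * x"] by (simp add: Dterm_def)

lemma bel1_pos_iff: "(\<forall>s\<in>{-1, 1}. bel1 m i s > 0) \<longleftrightarrow> \<bar>m i\<bar> < 1"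
  by (auto simp: bel1_def)

lemma one_minus_sq_mult_pos:
  fixes x y :: real
  assumes "\<bar>x\<bar> < 1" "\<bar>y\<bar> < 1"
  shows "(1 - x\<^sup>2) * (1 - y\<^sup>2) > 0"
  using assms by (intro mult_pos_pos) (simp_all add: abs_square_less_1)

lemma nxt_less: "nxt n i < n" if "n \<ge> 1"
  using that by (simp add: nxt_def)

text \<open>Here \<open>Q\<close> is any real number, not yet the product of the \<Theta>'s, so each
  edge of the ring can be treated separately. The product \<open>t * r\<close> plays the role of the
  susceptibility \<open>c i\<close>.\<close>

lemma susceptibility_equation_iff:
  fixes Q t x y e :: real
  assumes Q: "1 + Q \<noteq> 0" "1 - Q \<noteq> 0" and t: "t \<noteq> 0"
    and D: "Dterm Q x > 0" "Dterm Q y > 0"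
    and p: "p = (1 + Q) / (1 - Q) * tanh x" and q: "q = (1 + Q) / (1 - Q) * tanh y"
    and r: "r = sqrt ((1 - p\<^sup>2) * (1 - q\<^sup>2))"
  shows "e = t * r / (1 + Q)
           + Q / (1 + Q) * ((1 - p\<^sup>2) * (1 - q\<^sup>2) / (t * r) + 4 * (p * q / (1 + Q)))
     \<longleftrightarrow> t = ((1 + Q) * (1 - Q)\<^sup>2 * (e / sqrt ((1 - (tanh x)\<^sup>2) * (1 - (tanh y)\<^sup>2)))
              - 4 * Q * (1 + Q) * sinh x * sinh y) / sqrt (Dterm Q x * Dterm Q y) - Q / t"
    (is "e = ?rhs \<longleftrightarrow> _")
proof -
  define R where "R = sqrt (Dterm Q x * Dterm Q y)"
  define P where "P = cosh x * cosh y"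
  define K where "K = (1 + Q) * ((1 - Q)\<^sup>2 * P)"
  define S where "S = 4 * Q * (1 + Q) * sinh x * sinh y"
  have R: "R > 0" using D by (simp add: R_def)
  have P: "P > 0" by (simp add: P_def)
  have K: "K \<noteq> 0" using Q P by (simp add: K_def)
  \<comment> \<open>Both roots contribute a factor \<open>\<bar>1 - Q\<bar>\<close>, so their
    product is \<open>(1 - Q)\<^sup>2\<close> whatever the sign of \<open>1 - Q\<close>.\<close>
  have rR: "r = R / ((1 - Q)\<^sup>2 * P)"
    unfolding r p q one_minus_scaled_tanh_sq[OF Q(2)] R_def P_def
    by (simp add: real_sqrt_divide real_sqrt_mult abs_mult power2_eq_square)
  have "r > 0" using R P Q by (simp add: rR)
  moreover have "(1 - p\<^sup>2) * (1 - q\<^sup>2) = r * r"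
    using D unfolding r p q one_minus_scaled_tanh_sq[OF Q(2)] by simp
  ultimately have "(1 - p\<^sup>2) * (1 - q\<^sup>2) / (t * r) = r / t" by simp
  then have "?rhs = r / (1 + Q) * (t + Q / t) + 4 * Q * (p / (1 + Q)) * (q / (1 + Q))"
    by (simp add: algebra_simps add_divide_distrib)
  also have "r / (1 + Q) = R / K" by (simp add: rR K_def)
  \<comment> \<open>The factors \<open>1 + Q\<close> cancel against those in \<open>p\<close> and
    \<open>q\<close>, leaving \<open>tanh x * tanh y / (1 - Q)\<^sup>2\<close>.\<close>
  also have "4 * Q * (p / (1 + Q)) * (q / (1 + Q)) = S / K"
    using Q by (simp add: p q S_def K_def P_def tanh_def power2_eq_square) (simp add: ac_simps)
  finally have "e = ?rhs \<longleftrightarrow> e = (R * (t + Q / t) + S) / K"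
    by (simp add: add_divide_distrib)
  also have "\<dots> \<longleftrightarrow> t + Q / t = (K * e - S) / R"
    using K R by (auto simp: eq_divide_eq mult.commute)
  also have "\<dots> \<longleftrightarrow> t = (K * e - S) / R - Q / t" by linarith
  \<comment> \<open>The empirical square root equals \<open>1 / P\<close>, so \<open>P * e\<close>
    is the empirical \<Theta>.\<close>
  also have "K * e = (1 + Q) * (1 - Q)\<^sup>2 * (e / sqrt ((1 - (tanh x)\<^sup>2) * (1 - (tanh y)\<^sup>2)))"
    by (simp add: one_minus_tanh_sq real_sqrt_divide real_sqrt_mult K_def P_def)
  finally show ?thesis by (simp add: R_def S_def)
qed

text \<open>Once the magnetization equations hold, the edgewise equivalence applies at every index.
  One direction shows that solutions yield fixed points, the other that parameters rebuilt from a
  fixed point solve the susceptibility equations.\<close>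

lemma Theta_mem_ring_fixpoints_iff:
  assumes n: "n \<ge> 1" and mh: "\<forall>i<n. mh i = tanh (h i)"
    and adm: "admissible n m c"
    and m: "\<forall>i<n. mh i = ring_mag n m c i"
  shows "Theta n m c \<in> ring_fixpoints n h mh ch \<longleftrightarrow> (\<forall>i<n. ch i = ring_susc n m c i)"
proof -
  define t where "t = Theta n m c"
  define Q where "Q = Qprod n t"
  have Q: "1 + Q \<noteq> 0" "1 - Q \<noteq> 0" and c: "c i \<noteq> 0" and m1: "\<bar>m i\<bar> < 1" if "i < n" for i
    using adm that unfolding admissible_def bel1_pos_iff t_def Q_def by auto
  have Q: "1 + Q \<noteq> 0" "1 - Q \<noteq> 0" using Q n by fastforce+
  have mt: "m i = (1 + Q) / (1 - Q) * tanh (h i)" if "i < n" for i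
    using m mh Q that by (simp add: ring_mag_def Let_def t_def Q_def)
  have D: "Dterm Q (h i) > 0" if "i < n" for i
    using m1[OF that] mt[OF that] Dterm_pos_iff[OF Q(2)] by simp
  have eq: "ch i = ring_susc n m c i \<longleftrightarrow> t i = fmap n h mh ch t i" and t0: "t i \<noteq> 0"
    if i: "i < n" for i
  proof -
    let ?j = "nxt n i"
    define r where "r = sqrt ((1 - (m i)\<^sup>2) * (1 - (m ?j)\<^sup>2))"
    have j: "?j < n" using n by (rule nxt_less)
    have "r > 0" using m1[OF i] m1[OF j] by (simp add: r_def one_minus_sq_mult_pos)
    moreover have "t i = c i / r" using i by (simp add: t_def Theta_def r_def)
    ultimately have cr: "c i = t i * r" and t0: "t i \<noteq> 0" using c[OF i] by auto
    show "t i \<noteq> 0" by (fact t0)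
    show "ch i = ring_susc n m c i \<longleftrightarrow> t i = fmap n h mh ch t i"
      using susceptibility_equation_iff[OF Q t0 D[OF i] D[OF j] mt[OF i] mt[OF j] r_def, of "ch i"]
        i j mh
      by (simp add: ring_susc_def Let_def fmap_def Acoef_def cr Theta_def[of n mh]
          flip: t_def Q_def)
  qed
  \<comment> \<open>Outside \<open>{..<n}\<close> both sides are \<open>undefined\<close>, so only
    the indices below \<open>n\<close> matter.\<close>
  have ext: "t = fmap n h mh ch t \<longleftrightarrow> (\<forall>i<n. t i = fmap n h mh ch t i)"
    by (auto simp: fun_eq_iff t_def Theta_def fmap_def restrict_def)
  have "t \<in> {..<n} \<rightarrow>\<^sub>E UNIV" by (simp add: t_def Theta_def)
  then have "t \<in> ring_fixpoints n h mh ch \<longleftrightarrow> t = fmap n h mh ch t"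
    using t0 D Q by (simp add: ring_fixpoints_def flip: Q_def)
  then show ?thesis using eq by (simp add: ext flip: t_def)
qed

text \<open>This gives surjectivity: \<open>m\<close> solves the magnetization equations for the
  \<open>Q\<close> of the fixed point, and \<open>c\<close> is chosen so that its \<Theta> is
  \<open>t\<close>.\<close>

lemma fixpoint_parameters:
  assumes n: "n \<ge> 1" and mh: "\<forall>i<n. mh i = tanh (h i)"
    and t: "t \<in> ring_fixpoints n h mh ch"
  obtains m c where "(m, c) \<in> ring_solutions n mh ch" "Theta n m c = t"
proof -
  define Q where "Q = Qprod n t"
  define m where "m = (\<lambda>i\<in>{..<n}. (1 + Q) / (1 - Q) * tanh (h i))"
  define r where "r i = sqrt ((1 - (m i)\<^sup>2) * (1 - (m (nxt n i))\<^sup>2))" for i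
  define c where "c = (\<lambda>i\<in>{..<n}. t i * r i)"
  have Q1: "1 + Q \<noteq> 0" and t0: "t i \<noteq> 0" and D: "Dterm Q (h i) > 0" if "i < n" for i
    using t that by (auto simp: ring_fixpoints_def Q_def)
  have Q1: "1 + Q \<noteq> 0" using Q1 n by fastforce
  have Q2: "1 - Q \<noteq> 0" using D[of 0] n Dterm_one_nonpos[of "h 0"] by auto
  have m1: "\<bar>m i\<bar> < 1" if "i < n" for i
    using D[OF that] Dterm_pos_iff[OF Q2, of "h i"] that by (simp add: m_def)
  have r: "r i > 0" if "i < n" for i
    using m1[OF that] m1[OF nxt_less[OF n]] by (simp add: r_def one_minus_sq_mult_pos)
  have "t \<in> extensional {..<n}" using t by (simp add: ring_fixpoints_def PiE_def)
  \<comment> \<open>This closes the loop: the product computed from \<open>m\<close> and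
    \<open>c\<close> is the same \<open>Q\<close> from which \<open>m\<close> was built.\<close>
  then have th: "Theta n m c = t"
    using r by (force simp: Theta_def c_def r_def[symmetric] extensional_def fun_eq_iff)
  have "c i \<noteq> 0" if "i < n" for i using t0[OF that] r[OF that] that by (simp add: c_def)
  then have adm: "admissible n m c"
    using m1 Q1 Q2 unfolding admissible_def bel1_pos_iff th Q_def by auto
  have "ring_mag n m c i = (1 - Q) / (1 + Q) * m i" for i
    by (simp add: ring_mag_def Let_def th Q_def)
  then have mag: "\<forall>i<n. mh i = ring_mag n m c i"
    using mh Q1 Q2 by (simp add: m_def)
  have "\<forall>i<n. ch i = ring_susc n m c i"
    using Theta_mem_ring_fixpoints_iff[OF n mh adm mag] t th by simp
  then have "(m, c) \<in> ring_solutions n mh ch"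
    using adm mag by (simp add: ring_solutions_def m_def c_def)
  then show ?thesis using th that by blast
qed

text \<open>Equal \<Theta> means equal \<open>Q\<close>, and the nonzero factor
  \<open>(1 - Q) / (1 + Q)\<close> lets the magnetization equations fix \<open>m\<close>. The square
  roots then agree and are positive, so \<Theta> also fixes \<open>c\<close>.\<close>

lemma Theta_inj_on_solutions:
  assumes n: "n \<ge> 1"
  shows "inj_on (\<lambda>(m, c). Theta n m c) (ring_solutions n mh ch)"
proof (intro inj_onI, clarify)
  fix m c m' c'
  assume sol: "(m, c) \<in> ring_solutions n mh ch" "(m', c') \<in> ring_solutions n mh ch"
    and th: "Theta n m c = Theta n m' c'"
  define Q where "Q = Qprod n (Theta n m' c')"
  have ext: "m \<in> {..<n} \<rightarrow>\<^sub>E UNIV" "m' \<in> {..<n} \<rightarrow>\<^sub>E UNIV"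
      "c \<in> {..<n} \<rightarrow>\<^sub>E UNIV" "c' \<in> {..<n} \<rightarrow>\<^sub>E UNIV"
    and adm: "admissible n m c" "admissible n m' c'"
    and mag: "\<And>i. i < n \<Longrightarrow> ring_mag n m c i = ring_mag n m' c' i"
    using sol by (auto simp: ring_solutions_def)
  have m1: "\<bar>m i\<bar> < 1" if "i < n" for i
    using adm(1) that unfolding admissible_def bel1_pos_iff by blast
  have Q: "1 + Q \<noteq> 0" "1 - Q \<noteq> 0"
    using adm(2) unfolding admissible_def Q_def by blast+
  have mag: "(1 - Q) / (1 + Q) * m i = (1 - Q) / (1 + Q) * m' i" if "i < n" for i
    using mag[OF that] by (simp only: ring_mag_def Let_def th Q_def)
  have mm: "m = m'" using mag Q ext by (intro PiE_ext[OF ext(1,2)]) auto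
  have "c i = c' i" if i: "i < n" for i
  proof -
    have "sqrt ((1 - (m i)\<^sup>2) * (1 - (m (nxt n i))\<^sup>2)) > 0"
      using m1[OF i] m1[OF nxt_less[OF n]] by (simp add: one_minus_sq_mult_pos)
    moreover have "Theta n m c i = Theta n m c' i" using th mm by simp
    ultimately show ?thesis using i by (auto simp: Theta_def divide_cancel_right)
  qed
  then have "c = c'" by (intro PiE_ext[OF ext(3,4)]) auto
  with mm show "m = m' \<and> c = c'" by simp
qed

text \<open>That \<Theta> determines the solution is expressed as a bijection, covering both
  existence and uniqueness of the parameters behind a fixed point.\<close>

theorem proposition6p1:
  fixes n :: nat and h mh ch :: "nat \<Rightarrow> real"
  assumes "n \<ge> 1"
    and "\<forall>i<n. mh i = tanh (h i)"
  shows "bij_betw (\<lambda>(m, c). Theta n m c) (ring_solutions n mh ch) (ring_fixpoints n h mh ch)"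
  unfolding bij_betw_def
proof (intro conjI set_eqI iffI)
  show "inj_on (\<lambda>(m, c). Theta n m c) (ring_solutions n mh ch)"
    using assms(1) by (rule Theta_inj_on_solutions)
next
  fix t assume "t \<in> (\<lambda>(m, c). Theta n m c) ` ring_solutions n mh ch"
  then show "t \<in> ring_fixpoints n h mh ch"
    using Theta_mem_ring_fixpoints_iff[OF assms] by (auto simp: ring_solutions_def)
next
  fix t assume "t \<in> ring_fixpoints n h mh ch"
  then obtain m c where "(m, c) \<in> ring_solutions n mh ch" "Theta n m c = t"
    using fixpoint_parameters[OF assms] by blast
  then show "t \<in> (\<lambda>(m, c). Theta n m c) ` ring_solutions n mh ch" by force
qed

end
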